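(* Let $\mathcal{G}$ be a nonatomic aggregative game as described in the context, satisfying Assumptions (N1), (N2) and (N3). Then a profile $\bm{x}^*\in\mathcal{X}$, with aggregate $\bm{X}^*=\int_0^1\bm{x}^*_\theta\,d\theta$, is a Wardrop equilibrium of $\mathcal{G}$ if and only if either of the following two (equivalent) conditions holds: (a) for almost every $\theta\in\Theta$ there exists $\mathbf{g}_\theta\in\partial_1 f_\theta(\bm{x}^*_\theta,\bm{X}^* )$ such that $\langle \mathbf{g}_\theta,\bm{x}_\theta-\bm{x}^*_\theta\rangle\ge 0$ for all $\bm{x}_\theta\in\mathcal{X}_\theta$; (b) there exists $\mathbf{g}\in H(\bm{x}^* )$ such that $\int_\Theta\langle \mathbf{g}_\theta,\bm{x}_\theta-\bm{x}^*_\theta\rangle\,d\theta\ge 0$ for all $\bm{x}\in\mathcal{X}$.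
   Context: Nonatomic aggregative game: $T\ge 1$ is an integer, $\Theta=[0,1]$ carries Lebesgue measure. Each player $\theta\in\Theta$ has a pure-action set $\mathcal{X}_\theta\subset\mathbb{R}^T$ and a cost function $f_\theta(\bm{x}_\theta,\bm{X})$, where $\bm{X}\in\mathbb{R}^T$ is the aggregate action. The set of feasible pure-action profiles is $\mathcal{X}=\{\bm{x}\in L^2([0,1],\mathbb{R}^T):\bm{x}_\theta\in\mathcal{X}_\theta\text{ for a.e. }\theta\}$ and the aggregate of $\bm{x}$ is $\int\bm{x}=(\int_0^1 x_{\theta,t}\,d\theta)_{t=1}^T$. Let $\mathcal{S}=\{\int\bm{x}:\bm{x}\in\mathcal{X}\}$. Fix $M>0$, let $\mathcal{M}=[0,M+1]^T$ and let $\mathcal{M}'$ be a neighbourhood of $\mathcal{M}$. (N1) The correspondence $\theta\mapsto\mathcal{X}_\theta$ has nonempty, convex, compact values, its graph $\{(\theta,\bm{x}):\theta\in\Theta,\bm{x}\in\mathcal{X}_\theta\}$ is a Borel subset of $\mathbb{R}^{T+1}$, and $\mathcal{X}_\theta$ is contained in the closed ball of radius $M$ centered at $0$ for every $\theta$. (N2) Each $f_\theta$ is defined on $\mathcal{M}'\times\mathcal{M}'$ and bounded on $\mathcal{M}\times\mathcal{M}$, and for every $\bm{Y}\in\mathcal{M}$: (i) $(\theta,\bm{x})\mapsto f_\theta(\bm{x},\bm{Y})$ is measurable on the graph of $\theta\mapsto\mathcal{X}_\theta$; (ii) for each $\theta$, $\bm{x}\mapsto f_\theta(\bm{x},\bm{Y})$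 is continuous and convex on $\mathcal{M}'$; (iii) there is $B_f>0$ with $\|\mathbf{g}\|\le B_f$ for every $\mathbf{g}\in\partial_1 f_\theta(\bm{x},\bm{Y})$, all $\bm{x},\bm{Y}\in\mathcal{M}$, all $\theta$. Here $\partial_1 f_\theta(\bm{x},\bm{Y})$ is the subdifferential of the convex function $f_\theta(\cdot,\bm{Y})$ at $\bm{x}$. (N3) For $\bm{Y}\in\mathcal{S}$ let $Br(\bm{Y})=\{\bm{x}\in\mathcal{X}:\bm{x}_\theta\in\arg\min_{\mathcal{X}_\theta}f_\theta(\cdot,\bm{Y})\ \forall\theta\}$, and for $\bm{x}\in Br(\bm{Y})$ let $\mathcal{D}(\bm{x},\bm{Y})(\theta)=\{\mathbf{g}\in\partial_1 f_\theta(\bm{x}_\theta,\bm{Y}):\langle\mathbf{g},\bm{y}-\bm{x}_\theta\rangle\ge0\ \forall\bm{y}\in\mathcal{X}_\theta\}$. Assumption: for all $\bm{Y}\in\mathcal{S}$ and $\bm{x}\in Br(\bm{Y})$, $\theta\mapsto\mathcal{D}(\bm{x},\bm{Y})(\theta)$ is a measurable correspondence. For a profile $\bm{x}$, $H(\bm{x})=\{\mathbf{g}\in L^2([0,1],\mathbb{R}^T):\mathbf{g}_\theta\in\partial_1 f_\theta(\bm{x}_\theta,\int\bm{x})\text{ for a.e. }\theta\}$. A Wardrop equilibrium (WE) is $\bm{x}^*\in\mathcal{X}$ such that, with $\bm{X}^*=\int\bm{x}^*$, $f_\theta(\bm{x}^*_\theta,\bm{X}^* )\le f_\theta(\bm{x}_\theta,\bm{X}^*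 )$ for all $\bm{x}_\theta\in\mathcal{X}_\theta$ and a.e. $\theta$.
   Formalization: It is additionally assumed that every X_θ lies in the box M=[0,M+1]^T (nonnegative actions); otherwise f_θ(x_θ,X* ) may be undefined or nonconvex, and since (N2)(iii) bounds subgradients only on M, condition (b) can fail at an equilibrium. *)

theory Defs
  imports "HOL-Analysis.Analysis"
begin

text \<open>Player space Theta = [0,1] with Lebesgue measure; actions live in real^'t (T = CARD('t)).\<close>

abbreviation Theta :: "real measure" where
  "Theta \<equiv> lebesgue_on {0..1}"

definition Mbox :: "real \<Rightarrow> (real ^ 't) set" where
  "Mbox M = cbox 0 (\<chi> i. M + 1)"

definition L2prof :: "(real \<Rightarrow> real ^ 't) \<Rightarrow> bool" where
  "L2prof x \<longleftrightarrow> x \<in> borel_measurable Theta \<and> integrable Theta (\<lambda>\<theta>. (norm (x \<theta>))\<^sup>2)"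

definition feasible :: "(real \<Rightarrow> (real ^ 't) set) \<Rightarrow> (real \<Rightarrow> real ^ 't) \<Rightarrow> bool" where
  "feasible Xs x \<longleftrightarrow> L2prof x \<and> (AE \<theta> in Theta. x \<theta> \<in> Xs \<theta>)"

definition aggregate :: "(real \<Rightarrow> real ^ 't) \<Rightarrow> real ^ 't" where
  "aggregate x = (\<chi> t. LINT \<theta>|Theta. x \<theta> $ t)"

definition subdiff :: "(real ^ 't \<Rightarrow> real) \<Rightarrow> (real ^ 't) set \<Rightarrow> real ^ 't \<Rightarrow> (real ^ 't) set" where
  "subdiff h D x = {g. \<forall>y\<in>D. h x + g \<bullet> (y - x) \<le> h y}"

definition measurable_corr :: "'a measure \<Rightarrow> ('a \<Rightarrow> (real ^ 't) set) \<Rightarrow> bool" where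
  "measurable_corr \<Omega> F \<longleftrightarrow> (\<forall>U. open U \<longrightarrow> {\<theta>\<in>space \<Omega>. F \<theta> \<inter> U \<noteq> {}} \<in> sets \<Omega>)"

definition graph_corr :: "(real \<Rightarrow> (real ^ 't) set) \<Rightarrow> (real \<times> (real ^ 't)) set" where
  "graph_corr Xs = {(\<theta>, x). \<theta> \<in> {0..1} \<and> x \<in> Xs \<theta>}"

definition aggr_set :: "(real \<Rightarrow> (real ^ 't) set) \<Rightarrow> (real ^ 't) set" where
  "aggr_set Xs = {aggregate x | x. feasible Xs x}"

definition best_resp :: "(real \<Rightarrow> (real ^ 't) set) \<Rightarrow> (real \<Rightarrow> real ^ 't \<Rightarrow> real ^ 't \<Rightarrow> real)
    \<Rightarrow> real ^ 't \<Rightarrow> (real \<Rightarrow> real ^ 't) set" where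
  "best_resp Xs f Y = {x. feasible Xs x \<and>
      (\<forall>\<theta>\<in>{0..1}. x \<theta> \<in> Xs \<theta> \<and> (\<forall>y\<in>Xs \<theta>. f \<theta> (x \<theta>) Y \<le> f \<theta> y Y))}"

definition Dcorr :: "(real \<Rightarrow> (real ^ 't) set) \<Rightarrow> (real \<Rightarrow> real ^ 't \<Rightarrow> real ^ 't \<Rightarrow> real)
    \<Rightarrow> (real ^ 't) set \<Rightarrow> (real \<Rightarrow> real ^ 't) \<Rightarrow> real ^ 't \<Rightarrow> real \<Rightarrow> (real ^ 't) set" where
  "Dcorr Xs f M' x Y \<theta> = {g \<in> subdiff (\<lambda>z. f \<theta> z Y) M' (x \<theta>). \<forall>y\<in>Xs \<theta>. g \<bullet> (y - x \<theta>) \<ge> 0}"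

definition Hset :: "(real \<Rightarrow> real ^ 't \<Rightarrow> real ^ 't \<Rightarrow> real) \<Rightarrow> (real ^ 't) set
    \<Rightarrow> (real \<Rightarrow> real ^ 't) \<Rightarrow> (real \<Rightarrow> real ^ 't) set" where
  "Hset f M' x = {g. L2prof g \<and>
      (AE \<theta> in Theta. g \<theta> \<in> subdiff (\<lambda>z. f \<theta> z (aggregate x)) M' (x \<theta>))}"

definition wardrop_eq :: "(real \<Rightarrow> (real ^ 't) set) \<Rightarrow> (real \<Rightarrow> real ^ 't \<Rightarrow> real ^ 't \<Rightarrow> real)
    \<Rightarrow> (real \<Rightarrow> real ^ 't) \<Rightarrow> bool" where
  "wardrop_eq Xs f xs \<longleftrightarrow> feasible Xs xs \<and>
     (AE \<theta> in Theta. \<forall>y\<in>Xs \<theta>. f \<theta> (xs \<theta>) (aggregate xs) \<le> f \<theta> y (aggregate xs))"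

end

theory Submission
  imports Defs
begin

text \<open>At a fixed aggregate the equilibrium condition is a convex program for each player, so
  condition (a) is its first-order optimality condition. From the equilibrium to (b), (N3) yields a
  measurable subgradient field: the minimal-norm element of \<open>\<D>\<close>. Conversely, if the
  pointwise inequality failed on a set of players of positive measure, a feasible profile deviating
  only there would violate (b). That this set is measurable, and that the deviation can be chosen
  measurably, rests on the fact that the projection of a Borel set is Lebesgue measurable, which
  follows from a capacitability argument.\<close>

section \<open>Projections of Borel sets\<close>

text \<open>(N1) gives only a Borel graph, so the players whose violating actions meet a given open
  set are known only as a projection of a Borel set. Writing a Borel set as the projection of a
  closed set along Baire space restores compactness: once every entry of the code is bounded, what
  remains of a bounded set is compact. Both measurable choices, of subgradients and of deviations,
  use one device. In a nonempty closed convex set the point nearest to the origin is unique, so it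
  needs no arbitrary choice and inherits measurability from the correspondence. This dictates how a
  violation is expressed: with a margin \<open>\<epsilon>\<close> and a weak inequality, the
  violating actions are the action set cut by a closed half-space, hence closed and convex. A strict
  inequality would lose closedness; it is recovered from countably many margins.\<close>

definition analytic_set :: "'a::topological_space set \<Rightarrow> bool" where
  "analytic_set A \<longleftrightarrow> (\<exists>C :: ('a \<times> (nat \<Rightarrow> nat)) set. closed C \<and> A = fst ` C)"

lemma continuous_on_apply [continuous_intros]:
  fixes f :: "'a::topological_space \<Rightarrow> 'b \<Rightarrow> 'c::topological_space"
  assumes "continuous_on S f"
  shows "continuous_on S (\<lambda>x. f x i)"
  using assms by (rule continuous_on_product_then_coordinatewise)

lemma analytic_set_closed: "closed F \<Longrightarrow> analytic_set F"
  unfolding analytic_set_def by (rule exI[of _ "F \<times> UNIV"]) (auto intro: closed_Times)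

text \<open>The first entry of a code names one of the sets, and its tail is a code for membership
  in that set.\<close>

lemma analytic_set_Union:
  fixes A :: "nat \<Rightarrow> 'a::topological_space set"
  assumes "\<And>n. analytic_set (A n)"
  shows "analytic_set (\<Union>n. A n)"
proof -
  obtain C :: "nat \<Rightarrow> ('a \<times> (nat \<Rightarrow> nat)) set"
    where C: "\<And>n. closed (C n)" "\<And>n. A n = fst ` C n"
    using assms unfolding analytic_set_def by metis
  define tl where "tl = (\<lambda>p :: 'a \<times> (nat \<Rightarrow> nat). (fst p, \<lambda>k. snd p (Suc k)))"
  \<comment> \<open>In this form closedness is visible: the \<open>n\<close>-th condition binds only
    codes starting with \<open>n\<close>, and the set of all other codes is closed because
    \<open>nat\<close> is discrete.\<close>
  define D where "D = (\<Inter>n. {p. snd p 0 \<noteq> n} \<union> tl -` C n)"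
  have tl: "continuous_on UNIV tl"
    unfolding tl_def by (intro continuous_intros)
  have "closed {p :: 'a \<times> (nat \<Rightarrow> nat). snd p 0 \<noteq> n}" for n
  proof -
    have "closed ((\<lambda>p :: 'a \<times> (nat \<Rightarrow> nat). snd p 0) -` (- {n}))"
      by (intro closed_vimage continuous_intros) (simp add: closed_def open_discrete)
    then show ?thesis by (simp add: vimage_def)
  qed
  then have "closed D"
    unfolding D_def using C(1) tl by (intro closed_INT ballI closed_Un closed_vimage) auto
  moreover have "(\<Union>n. A n) = fst ` D"
  proof (intro set_eqI iffI)
    fix x assume "x \<in> (\<Union>n. A n)"
    then obtain n s where "(x, s) \<in> C n" using C(2) by force
    then have "(x, case_nat n s) \<in> D"
      by (auto simp: D_def tl_def)
    then show "x \<in> fst ` D" by force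
  next
    fix x assume "x \<in> fst ` D"
    then obtain s where "(x, s) \<in> D" by force
    then have "tl (x, s) \<in> C (s 0)" by (auto simp: D_def)
    then have "x \<in> A (s 0)" unfolding C(2) by (force simp: tl_def)
    then show "x \<in> (\<Union>n. A n)" by blast
  qed
  ultimately show ?thesis unfolding analytic_set_def by blast
qed

text \<open>One code can store countably many: \<open>prod_encode\<close> arranges its entries in a
  matrix whose \<open>n\<close>-th row is a code for the \<open>n\<close>-th set.\<close>

lemma analytic_set_Inter:
  fixes A :: "nat \<Rightarrow> 'a::topological_space set"
  assumes "\<And>n. analytic_set (A n)"
  shows "analytic_set (\<Inter>n. A n)"
proof -
  obtain C :: "nat \<Rightarrow> ('a \<times> (nat \<Rightarrow> nat)) set"
    where C: "\<And>n. closed (C n)" "\<And>n. A n = fst ` C n"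
    using assms unfolding analytic_set_def by metis
  define row where "row = (\<lambda>n (p :: 'a \<times> (nat \<Rightarrow> nat)). (fst p, \<lambda>k. snd p (prod_encode (n, k))))"
  define D where "D = (\<Inter>n. row n -` C n)"
  have row: "continuous_on UNIV (row n)" for n
    unfolding row_def by (intro continuous_intros)
  then have "closed D"
    unfolding D_def using C(1) by (intro closed_INT ballI closed_vimage) auto
  moreover have "(\<Inter>n. A n) = fst ` D"
  proof (intro set_eqI iffI)
    fix x assume "x \<in> (\<Inter>n. A n)"
    then have "\<exists>s. (x, s) \<in> C n" for n using C(2) by force
    then obtain s where "\<And>n. (x, s n) \<in> C n" by metis
    then have "(x, \<lambda>i. s (fst (prod_decode i)) (snd (prod_decode i))) \<in> D"
      by (auto simp: D_def row_def)
    then show "x \<in> fst ` D" by force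
  next
    fix x assume "x \<in> fst ` D"
    then obtain s where "(x, s) \<in> D" by force
    then have "row n (x, s) \<in> C n" for n by (auto simp: D_def)
    then have "x \<in> A n" for n unfolding C(2) by (force simp: row_def)
    then show "x \<in> (\<Inter>n. A n)" by blast
  qed
  ultimately show ?thesis unfolding analytic_set_def by blast
qed

lemma analytic_set_open:
  fixes U :: "'a::metric_space set"
  assumes "open U"
  shows "analytic_set U"
proof -
  have "fsigma_in euclidean U"
    using assms by (intro open_imp_fsigma_in) (auto simp: metrizable_space_euclidean)
  then obtain C where "\<And>n::nat. closed (C n)" "(\<Union>n. C n) = U"
    unfolding fsigma_in_ascending by auto
  then show ?thesis
    using analytic_set_Union[of C] by (auto intro: analytic_set_closed)
qed

text \<open>Complements of analytic sets need not be analytic, so the induction carries each set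
  together with its complement. The union step then uses closure under both countable unions and
  countable intersections.\<close>

lemma analytic_set_borel:
  fixes B :: "'a::metric_space set"
  assumes "B \<in> sets borel"
  shows "analytic_set B"
proof -
  have "B \<in> sigma_sets UNIV {S. open S}"
    using assms by (simp add: borel_def)
  then have "analytic_set B \<and> analytic_set (- B)"
  proof induction
    case (Basic S)
    then show ?case by (auto intro: analytic_set_open analytic_set_closed)
  next
    case Empty
    show ?case by (auto intro: analytic_set_closed)
  next
    case (Compl S)
    then show ?case by (simp add: Compl_eq_Diff_UNIV[symmetric])
  next
    case (Union S)
    then show ?case by (auto intro: analytic_set_Union analytic_set_Inter simp: Compl_UN)
  qed
  then show ?thesis ..
qed

text \<open>A product of finite sets, compact by Tychonoff. It replaces closed balls in Baire space,
  which is not locally compact.\<close>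

lemma compact_nat_box: "compact {s :: nat \<Rightarrow> nat. \<forall>k. s k \<le> m k}"
proof -
  have "compactin (product_topology (\<lambda>i. euclidean) UNIV) (PiE UNIV (\<lambda>k. {..m k}))"
    by (subst compactin_PiE) (auto intro: finite_imp_compact)
  then show ?thesis
    by (simp add: euclidean_product_topology PiE_UNIV_domain Pi_def)
qed

lemma tendsto_fun_iff:
  fixes f :: "'c \<Rightarrow> 'a \<Rightarrow> 'b::topological_space"
  shows "(f \<longlongrightarrow> l) F \<longleftrightarrow> (\<forall>i. ((\<lambda>x. f x i) \<longlongrightarrow> l i) F)"
  using limitin_componentwise[of "\<lambda>_. euclidean" UNIV f l F]
  by (simp add: euclidean_product_topology)

text \<open>Choquet's argument: outer measure is continuous along increasing unions, so the coordinates of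
  the code \<open>s\<close> can be bounded one after another at no cost; bounding all of them leaves a compact
  part of \<open>C\<close>, and by compactness the projections of the partially bounded sets shrink to that of
  the compact part.\<close>
lemma capacity_closed:
  fixes C :: "('c::euclidean_space \<times> (nat \<Rightarrow> nat)) set"
    and h :: "'c \<Rightarrow> 'a::euclidean_space"
  assumes C: "closed C" and bdd: "bounded (fst ` C)" and h: "continuous_on UNIV h"
    and b: "b < outer_measure_of lborel (h ` fst ` C)"
  obtains K where "compact K" "K \<subseteq> h ` fst ` C" "b \<le> emeasure lborel K"
proof -
  let ?\<mu> = "outer_measure_of (lborel :: 'a measure)"
  define P where "P = (\<lambda>p :: 'c \<times> (nat \<Rightarrow> nat). h (fst p))"
  have P: "continuous_on UNIV P"
    unfolding P_def by (intro continuous_on_compose2[OF h] continuous_intros) auto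
  have PC: "h ` fst ` C = P ` C" by (auto simp: P_def)
  define Q where "Q = (\<lambda>ms :: nat list. {p \<in> C. \<forall>j < length ms. snd p j \<le> ms ! j})"
  \<comment> \<open>Outer measure is used because the projections are not known to be measurable.
    The strict inequality lets a single term of the supremum already exceed
    \<open>b\<close>.\<close>
  have step: "\<exists>m. b < ?\<mu> (P ` Q (ms @ [m]))" if "b < ?\<mu> (P ` Q ms)" for ms
  proof -
    have Q_snoc: "Q (ms @ [m]) = {p \<in> Q ms. snd p (length ms) \<le> m}" for m
      by (auto simp: Q_def nth_append less_Suc_eq)
    have "(SUP m. ?\<mu> (P ` Q (ms @ [m]))) = ?\<mu> (\<Union>m. P ` Q (ms @ [m]))"
      by (intro SUP_outer_measure_of_incseq incseq_SucI) (auto simp: Q_snoc)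
    also have "(\<Union>m. P ` Q (ms @ [m])) = P ` (\<Union>m. Q (ms @ [m]))"
      by blast
    also have "(\<Union>m. Q (ms @ [m])) = Q ms"
      by (auto simp: Q_snoc)
    finally have "b < (SUP m. ?\<mu> (P ` Q (ms @ [m])))" using that by (simp only:)
    then show ?thesis by (simp only: less_SUP_iff) blast
  qed
  then obtain nxt where nxt: "\<And>ms. b < ?\<mu> (P ` Q ms) \<Longrightarrow> b < ?\<mu> (P ` Q (ms @ [nxt ms]))"
    by metis
  define l where "l = rec_nat [] (\<lambda>_ ms. ms @ [nxt ms])"
  define m where "m = (\<lambda>k. nxt (l k))"
  have l: "l 0 = []" "l (Suc k) = l k @ [m k]" for k
    by (auto simp: l_def m_def)
  have l_map: "l k = map m [0..<k]" for k
    by (induction k) (auto simp: l)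
  define R where "R = (\<lambda>k. {p \<in> C. \<forall>j<k. snd p j \<le> m j})"
  have QR: "Q (l k) = R k" for k
    by (auto simp: Q_def R_def l_map)
  have "b < ?\<mu> (P ` Q (l k))" for k
  proof (induction k)
    case 0
    then show ?case using b by (simp add: Q_def l PC)
  next
    case (Suc k)
    then show ?case using nxt by (simp add: l m_def)
  qed
  then have bR: "b < ?\<mu> (P ` R k)" for k by (simp add: QR)
  define L where "L = {p \<in> C. \<forall>j. snd p j \<le> m j}"
  define W where "W = closure (fst ` C) \<times> {s. \<forall>k. s k \<le> m k}"
  have W: "compact W"
    unfolding W_def using bdd by (intro compact_Times compact_nat_box) auto
  have "L = C \<inter> W"
    unfolding L_def W_def using closure_subset[of "fst ` C"] by (auto simp: mem_Times_iff)
  then have L: "compact L" using C W by (simp add: closed_Int_compact)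
  have limit: "t \<in> P ` L" if t: "\<And>k. t \<in> closure (P ` R k)" for t
  proof -
    have "\<exists>p\<in>R k. dist (P p) t < inverse (Suc k)" for k
      using t[of k] unfolding closure_approachable by force
    then obtain p where p: "\<And>k. p k \<in> R k" "\<And>k. dist (P (p k)) t < inverse (Suc k)"
      by metis
    \<comment> \<open>The code of \<open>p k\<close> is bounded only at entries below
      \<open>k\<close>, so convergence of a subsequence is not immediate. Truncation by
      \<open>m\<close> moves the points into the compact \<open>W\<close>, and it leaves entry
      \<open>j\<close> unchanged as soon as the index exceeds \<open>j\<close>.\<close>
    define q where "q = (\<lambda>k. (fst (p k), \<lambda>j. min (snd (p k) j) (m j)))"
    have "q k \<in> W" for k
      unfolding q_def W_def using p(1)[of k] closure_subset[of "fst ` C"]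
      by (auto simp: R_def)
    moreover have "seq_compact W"
      using W by (rule compact_imp_seq_compact)
    ultimately obtain z r where z: "z \<in> W" "strict_mono r" "(q \<circ> r) \<longlonglongrightarrow> z"
      using seq_compactE[of W q] by blast
    have fst_lim: "(\<lambda>k. fst (p (r k))) \<longlonglongrightarrow> fst z"
      using tendsto_fst[OF z(3)] by (simp add: q_def o_def)
    have "(\<lambda>k. snd (p (r k)) j) \<longlonglongrightarrow> snd z j" for j
    proof (rule Lim_transform_eventually)
      show "(\<lambda>k. snd (q (r k)) j) \<longlonglongrightarrow> snd z j"
        using tendsto_snd[OF z(3)] unfolding tendsto_fun_iff by (simp add: o_def)
      have "snd (q (r k)) j = snd (p (r k)) j" if "k > j" for k
      proof -
        have "j < r k" using that seq_suble[OF z(2), of k] by linarith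
        then show ?thesis using p(1)[of "r k"] by (auto simp: q_def R_def)
      qed
      then show "\<forall>\<^sub>F k in sequentially. snd (q (r k)) j = snd (p (r k)) j"
        by (rule eventually_mono[OF eventually_gt_at_top[of j]])
    qed
    then have "(\<lambda>k. snd (p (r k))) \<longlonglongrightarrow> snd z" unfolding tendsto_fun_iff by simp
    then have pz: "(\<lambda>k. p (r k)) \<longlonglongrightarrow> z"
      using tendsto_Pair[OF fst_lim] by fastforce
    have "z \<in> C"
      by (rule closed_sequentially[OF C _ pz]) (use p(1) in \<open>auto simp: R_def\<close>)
    with z(1) have "z \<in> L" by (auto simp: \<open>L = C \<inter> W\<close>)
    have "(\<lambda>k. P (p (r k))) \<longlonglongrightarrow> P z"
      by (rule continuous_on_tendsto_compose[OF P pz]) auto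
    moreover have "(\<lambda>k. P (p k)) \<longlonglongrightarrow> t"
      unfolding tendsto_dist_iff[of _ t]
      by (rule tendsto_sandwich[OF _ _ tendsto_const LIMSEQ_inverse_real_of_nat])
        (auto intro!: always_eventually less_imp_le[OF p(2)] simp del: of_nat_Suc)
    then have "(\<lambda>k. P (p (r k))) \<longlonglongrightarrow> t"
      using LIMSEQ_subseq_LIMSEQ[OF _ z(2)] by (simp add: o_def)
    ultimately have "t = P z" by (metis LIMSEQ_unique)
    with \<open>z \<in> L\<close> show ?thesis by blast
  qed
  \<comment> \<open>Closures make the projections measurable and, by \<open>limit\<close>, add
    nothing outside \<open>P\<close> applied to \<open>L\<close> in the intersection. Boundedness
    gives the finite measure that continuity from above requires.\<close>
  define T where "T = (\<lambda>k. closure (P ` R k))"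
  have TL: "(\<Inter>k. T k) \<subseteq> P ` L"
    using limit by (auto simp: T_def)
  have "bounded (P ` C)"
  proof -
    have "compact (h ` closure (fst ` C))"
      using bdd by (intro compact_continuous_image continuous_on_subset[OF h]) auto
    then show ?thesis
      unfolding PC[symmetric]
      by (rule bounded_subset[OF compact_imp_bounded]) (intro image_mono closure_subset)
  qed
  then have "bounded (P ` R k)" for k
    by (rule bounded_subset) (auto simp: R_def)
  then have fin: "emeasure lborel (T k) \<noteq> \<infinity>" for k
    using emeasure_bounded_finite[of "T k"] by (auto simp: T_def bounded_closure)
  have "b \<le> (INF k. emeasure lborel (T k))"
  proof (rule INF_greatest)
    fix k
    have "?\<mu> (P ` R k) \<le> ?\<mu> (T k)"
      unfolding T_def by (intro outer_measure_of_mono closure_subset)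
    also have "\<dots> = emeasure lborel (T k)"
      by (simp add: T_def)
    finally show "b \<le> emeasure lborel (T k)" using bR[of k] by simp
  qed
  also have "\<dots> = emeasure lborel (\<Inter>k. T k)"
  proof (rule INF_emeasure_decseq)
    show "decseq T"
      unfolding T_def R_def by (intro decseq_SucI closure_mono image_mono) auto
  qed (use fin in \<open>auto simp: T_def\<close>)
  also have "\<dots> \<le> emeasure lborel (P ` L)"
    using compact_continuous_image[OF continuous_on_subset[OF P] L]
    by (intro emeasure_mono TL) (auto intro: borel_compact)
  finally have "b \<le> emeasure lborel (P ` L)" .
  moreover have "compact (P ` L)"
    using compact_continuous_image[OF continuous_on_subset[OF P] L] by auto
  moreover have "P ` L \<subseteq> h ` fst ` C"
    unfolding PC by (auto simp: L_def)
  ultimately show ?thesis using that by blast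
qed

text \<open>The projection is squeezed between a countable union \<open>S\<close> of compact sets
  and a Borel hull \<open>V\<close> of the same measure. Boundedness makes that measure finite, so
  equality of measures forces \<open>V - S\<close> to be null.\<close>

lemma sets_lebesgue_fst_image_bounded:
  fixes B :: "('a::euclidean_space \<times> 'b::euclidean_space) set"
  assumes B: "B \<in> sets borel" and bdd: "bounded B"
  shows "fst ` B \<in> sets lebesgue"
proof -
  obtain C :: "(('a \<times> 'b) \<times> (nat \<Rightarrow> nat)) set" where C: "closed C" "B = fst ` C"
    using analytic_set_borel[OF B] unfolding analytic_set_def by blast
  define a where "a = outer_measure_of lborel (fst ` B)"
  obtain V where V: "V \<in> sets borel" "fst ` B \<subseteq> V" "a = emeasure lborel V"
    using outer_measure_of_attain[of "fst ` B" lborel] by (auto simp: a_def)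
  have "bounded (fst ` B)" using bdd by (rule bounded_fst)
  then obtain c where "fst ` B \<subseteq> cball 0 c" by (metis bounded_iff mem_cball_0 subsetI)
  then have "a \<le> emeasure lborel (cball (0::'a) c)"
    unfolding a_def by (metis outer_measure_of_mono outer_measure_of_eq sets_lborel borel_closed closed_cball)
  also have "\<dots> < \<infinity>" by (intro emeasure_bounded_finite) auto
  finally have fin: "a < \<infinity>" .
  define \<K> where "\<K> = {K. compact K \<and> K \<subseteq> fst ` B}"
  have "a \<le> (SUP K\<in>\<K>. emeasure lborel K)"
  proof (rule dense_le)
    fix b assume "b < a"
    then obtain K where "compact K" "K \<subseteq> fst ` B" "b \<le> emeasure lborel K"
      using capacity_closed[of C fst b] C bdd continuous_on_fst[OF continuous_on_id]
      by (auto simp: a_def)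
    then show "b \<le> (SUP K\<in>\<K>. emeasure lborel K)"
      by (intro SUP_upper2[of K]) (auto simp: \<K>_def)
  qed
  moreover have "{} \<in> \<K>" by (auto simp: \<K>_def)
  then obtain g :: "nat \<Rightarrow> ennreal" where g: "range g \<subseteq> emeasure lborel ` \<K>" "(SUP K\<in>\<K>. emeasure lborel K) = (SUP n. g n)"
    using ennreal_Sup_countable_SUP[of "emeasure lborel ` \<K>"] by blast
  then have "\<forall>n. \<exists>K\<in>\<K>. g n = emeasure lborel K"
    by blast
  then obtain K where K: "\<And>n. K n \<in> \<K>" "\<And>n. g n = emeasure lborel (K n)"
    by metis
  define S where "S = (\<Union>n. K n)"
  have S: "S \<in> sets borel"
    unfolding S_def using K(1) by (auto simp: \<K>_def intro: borel_compact)
  have "g n \<le> emeasure lborel S" for n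
    unfolding K(2) S_def by (rule emeasure_mono) (use S in \<open>auto simp: S_def\<close>)
  ultimately have "a \<le> emeasure lborel S"
    using g(2) by (metis SUP_least order_trans)
  have SB: "S \<subseteq> fst ` B" using K(1) by (auto simp: \<K>_def S_def)
  have "emeasure lborel (V - S) = emeasure lborel V - emeasure lborel S"
  proof (rule emeasure_Diff)
    have "emeasure lborel S \<le> a"
      unfolding V(3) using SB V by (intro emeasure_mono) auto
    then show "emeasure lborel S \<noteq> \<infinity>" using fin by auto
  qed (use S V SB in auto)
  then have "emeasure lborel (V - S) = 0"
    using \<open>a \<le> emeasure lborel S\<close> V(3) fin by (simp add: diff_eq_0_iff_ennreal)
  then have "V - S \<in> null_sets lborel" using V S by (auto intro: null_setsI)
  then show ?thesis
    using SB V by (intro sets_completionI[of _ S "fst ` B - S" "V - S"]) (auto simp: S)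
qed

theorem sets_lebesgue_fst_image:
  fixes B :: "('a::euclidean_space \<times> 'b::euclidean_space) set"
  assumes "B \<in> sets borel"
  shows "fst ` B \<in> sets lebesgue"
proof -
  have "fst ` B = (\<Union>n::nat. fst ` (B \<inter> cball 0 n))"
    using real_arch_simple by (fastforce simp: image_iff)
  also have "\<dots> \<in> sets lebesgue"
  proof (intro sets.countable_UN image_subsetI)
    fix n :: nat
    show "fst ` (B \<inter> cball 0 n) \<in> sets lebesgue"
      using assms by (intro sets_lebesgue_fst_image_bounded) (auto intro: bounded_Int)
  qed
  finally show ?thesis .
qed

section \<open>Measurable selections and subgradients\<close>

text \<open>The squared distance to \<open>F\<close> has gradient \<open>-2 * closest_point F 0\<close> at the origin, which makes
  the nearest point a limit of difference quotients of measurable distance functions.\<close>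
lemma infdist_sq_closest_point:
  fixes F :: "'a::euclidean_space set"
  assumes F: "convex F" "closed F" "F \<noteq> {}"
  shows "\<bar>(infdist a F)\<^sup>2 - (infdist 0 F)\<^sup>2 + 2 * (a \<bullet> closest_point F 0)\<bar> \<le> (norm a)\<^sup>2"
proof -
  define p where "p = closest_point F 0"
  define q where "q = closest_point F a"
  have pq: "p \<in> F" "q \<in> F"
    using F by (auto simp: p_def q_def closest_point_in_set)
  have infdist_eq: "infdist z F = dist z (closest_point F z)" for z
    using setdist_closest_point[OF F(2,3)] by (simp add: infdist_eq_setdist)
  have d0: "infdist 0 F = norm p" and da: "infdist a F = norm (a - q)"
    by (simp_all add: infdist_eq p_def q_def dist_norm)
  \<comment> \<open>For the upper bound \<open>p\<close> competes with \<open>q\<close> at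
    \<open>a\<close>; for the lower bound \<open>q\<close> competes with \<open>p\<close> at the
    origin.\<close>
  have "norm (a - q) \<le> norm (a - p)"
    using closest_point_le[OF F(2) pq(1), of a] by (simp add: q_def dist_norm)
  then have "(norm (a - q))\<^sup>2 \<le> (norm (a - p))\<^sup>2"
    by (simp add: power_mono)
  also have "\<dots> = (norm p)\<^sup>2 - 2 * (a \<bullet> p) + (norm a)\<^sup>2"
    by (simp add: power2_norm_eq_inner inner_diff inner_commute)
  finally have upper: "(norm (a - q))\<^sup>2 - (norm p)\<^sup>2 + 2 * (a \<bullet> p) \<le> (norm a)\<^sup>2"
    by simp
  have "norm p \<le> norm q"
    using closest_point_le[OF F(2) pq(2), of 0] by (simp add: p_def)
  then have "(norm p)\<^sup>2 \<le> (norm q)\<^sup>2"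
    by (simp add: power_mono)
  moreover have "(norm (a - q))\<^sup>2 = (norm q)\<^sup>2 - 2 * (a \<bullet> q) + (norm a)\<^sup>2"
    by (simp add: power2_norm_eq_inner inner_diff inner_commute)
  \<comment> \<open>The nearest-point map of a convex set is 1-Lipschitz; this keeps the error in
    the lower bound quadratic in \<open>a\<close>.\<close>
  moreover have "a \<bullet> (q - p) \<le> (norm a)\<^sup>2"
  proof -
    have "norm (q - p) \<le> norm a"
      using closest_point_lipschitz[OF F, of a 0] by (simp add: p_def q_def dist_norm)
    then have "norm a * norm (q - p) \<le> norm a * norm a"
      by (simp add: mult_left_mono)
    then show ?thesis
      using norm_cauchy_schwarz[of a "q - p"] by (simp add: power2_eq_square)
  qed
  ultimately have "- (norm a)\<^sup>2 \<le> (norm (a - q))\<^sup>2 - (norm p)\<^sup>2 + 2 * (a \<bullet> p)"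
    unfolding inner_diff_right by linarith
  with upper show ?thesis
    unfolding d0 da p_def[symmetric] by linarith
qed

lemma borel_measurable_closest_point:
  fixes F :: "'b \<Rightarrow> (real ^ 't) set"
  assumes F: "\<And>\<theta>. \<theta> \<in> space \<Omega> \<Longrightarrow> convex (F \<theta>) \<and> closed (F \<theta>) \<and> F \<theta> \<noteq> {}"
    and meas: "measurable_corr \<Omega> F"
  shows "(\<lambda>\<theta>. closest_point (F \<theta>) 0) \<in> borel_measurable \<Omega>"
proof -
  \<comment> \<open>The distance from \<open>a\<close> is below \<open>c\<close> exactly when the
    set meets the open ball of radius \<open>c\<close>, which is the test in
    \<open>measurable_corr\<close>.\<close>
  have dist_meas: "(\<lambda>\<theta>. infdist a (F \<theta>)) \<in> borel_measurable \<Omega>" for a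
  proof (rule borel_measurableI_less)
    fix c :: real
    have "infdist a (F \<theta>) < c \<longleftrightarrow> F \<theta> \<inter> ball a c \<noteq> {}" if "\<theta> \<in> space \<Omega>" for \<theta>
      using F[OF that] by (auto simp: infdist_def cINF_less_iff)
    then have "{\<theta> \<in> space \<Omega>. infdist a (F \<theta>) < c} = {\<theta> \<in> space \<Omega>. F \<theta> \<inter> ball a c \<noteq> {}}"
      by blast
    then show "{\<theta> \<in> space \<Omega>. infdist a (F \<theta>) < c} \<in> sets \<Omega>"
      using meas by (simp add: measurable_corr_def)
  qed
  have "(\<lambda>\<theta>. v \<bullet> closest_point (F \<theta>) 0) \<in> borel_measurable \<Omega>" for v
  proof (rule borel_measurable_LIMSEQ_real)
    \<comment> \<open>The difference quotient in direction \<open>v\<close> with step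
      \<open>1/(n+1)\<close>, multiplied by \<open>-1/2\<close> to cancel the factor of the
      gradient. The quadratic error then shrinks like \<open>1/(n+1)\<close>.\<close>
    define d where "d = (\<lambda>n \<theta>. - (real (Suc n) / 2) *
      ((infdist (inverse (Suc n) *\<^sub>R v) (F \<theta>))\<^sup>2 - (infdist 0 (F \<theta>))\<^sup>2))"
    show "d n \<in> borel_measurable \<Omega>" for n
      unfolding d_def using dist_meas by measurable
    fix \<theta> assume \<theta>: "\<theta> \<in> space \<Omega>"
    have bound: "\<bar>v \<bullet> closest_point (F \<theta>) 0 - d n \<theta>\<bar> \<le> (norm v)\<^sup>2 / 2 * inverse (Suc n)" for n
    proof -
      let ?n = "real (Suc n)"
      let ?D = "(infdist (inverse ?n *\<^sub>R v) (F \<theta>))\<^sup>2 - (infdist 0 (F \<theta>))\<^sup>2"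
      let ?c = "v \<bullet> closest_point (F \<theta>) 0"
      have "\<bar>?D + 2 * (inverse ?n * ?c)\<bar> \<le> (inverse ?n * norm v)\<^sup>2"
        using infdist_sq_closest_point[of "F \<theta>" "inverse ?n *\<^sub>R v"] F[OF \<theta>] by simp
      then have "?n / 2 * \<bar>?D + 2 * (inverse ?n * ?c)\<bar> \<le> ?n / 2 * (inverse ?n * norm v)\<^sup>2"
        by (intro mult_left_mono) auto
      moreover have "?n / 2 * \<bar>?D + 2 * (inverse ?n * ?c)\<bar> = \<bar>?n / 2 * (?D + 2 * (inverse ?n * ?c))\<bar>"
        by (simp add: abs_mult)
      moreover have "?n / 2 * (?D + 2 * (inverse ?n * ?c)) = ?c - d n \<theta>"
        unfolding d_def distrib_left by simp
      moreover have "?n / 2 * (inverse ?n * norm v)\<^sup>2 = (norm v)\<^sup>2 / 2 * inverse ?n"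
        by (simp add: power_mult_distrib power2_eq_square del: of_nat_Suc)
      ultimately show ?thesis by (simp only:)
    qed
    have "(\<lambda>n. (norm v)\<^sup>2 / 2 * inverse (Suc n)) \<longlonglongrightarrow> 0"
      using tendsto_mult_right_zero[OF LIMSEQ_inverse_real_of_nat] by simp
    then have "(\<lambda>n. v \<bullet> closest_point (F \<theta>) 0 - d n \<theta>) \<longlonglongrightarrow> 0"
      by (rule Lim_null_comparison[OF always_eventually, rotated]) (simp only: real_norm_def bound simp_thms)
    then have "(\<lambda>n. v \<bullet> closest_point (F \<theta>) 0 - (v \<bullet> closest_point (F \<theta>) 0 - d n \<theta>))
        \<longlonglongrightarrow> v \<bullet> closest_point (F \<theta>) 0 - 0"
      by (intro tendsto_diff tendsto_const)
    then show "(\<lambda>n. d n \<theta>) \<longlonglongrightarrow> v \<bullet> closest_point (F \<theta>) 0" by simp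
  qed
  then show ?thesis
    by (subst borel_measurable_euclidean_space) (auto simp: inner_commute)
qed

text \<open>Separating the strict epigraph of \<open>h\<close> from \<open>X \<times> (-\<infinity>, h x]\<close>; the hyperplane is not
  vertical because \<open>x\<close> is interior to \<open>D\<close>.\<close>
lemma constrained_minimizer_subgradient:
  fixes h :: "real ^ 't \<Rightarrow> real"
  assumes D: "open D" and h: "convex_on D h"
    and X: "convex X" "X \<subseteq> D" "x \<in> X" and min: "\<And>y. y \<in> X \<Longrightarrow> h x \<le> h y"
  obtains g where "g \<in> subdiff h D x" "\<And>y. y \<in> X \<Longrightarrow> g \<bullet> (y - x) \<ge> 0"
proof -
  define A where "A = {p. fst p \<in> D \<and> h (fst p) < snd p}"
  define B where "B = X \<times> {..h x}"
  have xD: "x \<in> D" using X by blast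
  have "convex A"
  proof (rule convexI)
    fix p q :: "(real ^ 't) \<times> real" and u v :: real
    assume *: "p \<in> A" "q \<in> A" "0 \<le> u" "0 \<le> v" "u + v = 1"
    have "convex D" using h by (simp add: convex_on_def)
    then have "u *\<^sub>R fst p + v *\<^sub>R fst q \<in> D"
      using * by (auto simp: A_def convex_def)
    moreover have "h (u *\<^sub>R fst p + v *\<^sub>R fst q) \<le> u * h (fst p) + v * h (fst q)"
      using * h by (auto simp: A_def convex_on_def)
    moreover have "u * h (fst p) + v * h (fst q) < u * snd p + v * snd q"
    proof (cases "u = 0")
      case True
      then show ?thesis using * by (auto simp: A_def)
    next
      case False
      then have "u * h (fst p) < u * snd p" "v * h (fst q) \<le> v * snd q"
        using * by (auto simp: A_def intro: mult_left_mono)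
      then show ?thesis by linarith
    qed
    ultimately show "u *\<^sub>R p + v *\<^sub>R q \<in> A" by (auto simp: A_def)
  qed
  moreover have "convex B" unfolding B_def using X(1) by (intro convex_Times) auto
  moreover have "(x, h x + 1) \<in> A" using xD by (auto simp: A_def)
  moreover have "(x, h x) \<in> B" using X by (auto simp: B_def)
  moreover have "A \<inter> B = {}" using min by (force simp: A_def B_def)
  ultimately obtain w b where w: "w \<noteq> 0" "\<And>p. p \<in> A \<Longrightarrow> b \<le> w \<bullet> p" "\<And>p. p \<in> B \<Longrightarrow> w \<bullet> p \<le> b"
    using separating_hyperplane_sets[of B A] by blast
  define a c where "a = fst w" and "c = snd w"
  have upper: "b \<le> a \<bullet> y + c * t" if "y \<in> D" "h y < t" for y t
    using w(2)[of "(y, t)"] that by (simp add: A_def a_def c_def inner_prod_def)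
  have lower: "a \<bullet> y + c * t \<le> b" if "y \<in> X" "t \<le> h x" for y t
    using w(3)[of "(y, t)"] that by (simp add: B_def a_def c_def inner_prod_def)
  \<comment> \<open>The strict epigraph keeps \<open>A\<close> and \<open>B\<close> disjoint; its
    boundary is reached by letting \<open>t\<close> decrease to \<open>h y\<close>.\<close>
  have epi: "b \<le> a \<bullet> y + c * h y" if "y \<in> D" for y
  proof (rule tendsto_lowerbound)
    show "((\<lambda>t. a \<bullet> y + c * t) \<longlongrightarrow> a \<bullet> y + c * h y) (at_right (h y))"
      by (intro tendsto_intros)
    show "\<forall>\<^sub>F t in at_right (h y). b \<le> a \<bullet> y + c * t"
      using upper[OF that] by (auto simp: eventually_at_filter)
  qed simp
  have bx: "b = a \<bullet> x + c * h x"
    using epi[OF xD] lower[OF X(3), of "h x"] by simp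
  have "c \<ge> 0" using upper[OF xD, of "h x + 1"] bx by (simp add: algebra_simps)
  moreover have "c \<noteq> 0"
  proof
    assume c0: "c = 0"
    then have "a \<noteq> 0" using w(1) by (auto simp: a_def c_def prod_eq_iff)
    obtain e where e: "e > 0" "cball x e \<subseteq> D"
      using D xD open_contains_cball by blast
    let ?y = "x - (e / norm a) *\<^sub>R a"
    \<comment> \<open>With \<open>c = 0\<close> the functional \<open>a\<close> would attain its
      minimum over \<open>D\<close> at \<open>x\<close>, but a step of length \<open>e\<close>
      against \<open>a\<close> stays in \<open>D\<close> and lowers it.\<close>
    have "?y \<in> D"
      using e \<open>a \<noteq> 0\<close> by (intro subsetD[OF e(2)]) (simp add: dist_norm)
    then have "a \<bullet> x \<le> a \<bullet> ?y" using epi bx c0 by simp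
    then have "(e / norm a) * (a \<bullet> a) \<le> 0" by (simp add: inner_diff_right)
    moreover have "(e / norm a) * (a \<bullet> a) > 0" using e \<open>a \<noteq> 0\<close> by simp
    ultimately show False by simp
  qed
  ultimately have "c > 0" by simp
  \<comment> \<open>One hyperplane serves both claims: \<open>epi\<close> divided by
    \<open>c\<close> is the subgradient inequality, and \<open>lower\<close> at height
    \<open>h x\<close> is the variational inequality on \<open>X\<close>.\<close>
  define g where "g = - (inverse c *\<^sub>R a)"
  show ?thesis
  proof
    have "h x + g \<bullet> (y - x) \<le> h y" if "y \<in> D" for y
    proof -
      have "c * (h x + g \<bullet> (y - x)) = c * h x - a \<bullet> (y - x)"
        using \<open>c > 0\<close> by (simp add: g_def distrib_left right_diff_distrib flip: mult.assoc)
      also have "\<dots> \<le> c * h y"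
        using epi[OF that] bx by (simp add: inner_diff_right)
      finally show ?thesis using \<open>c > 0\<close> by simp
    qed
    then show "g \<in> subdiff h D x" by (simp add: subdiff_def)
    fix y assume "y \<in> X"
    then have "a \<bullet> (y - x) \<le> 0"
      using lower[of y "h x"] bx by (simp add: inner_diff_right)
    then show "g \<bullet> (y - x) \<ge> 0"
      using \<open>c > 0\<close> by (simp add: g_def mult_le_0_iff)
  qed
qed

section \<open>Profiles of actions\<close>

lemma Theta_simps [simp]: "space Theta = {0..1}" "measure Theta {0..1} = 1"
  by (simp_all add: measure_restrict_space)

lemma sets_Theta: "A \<in> sets Theta \<longleftrightarrow> A \<subseteq> {0..1} \<and> A \<in> sets lebesgue"
  by (subst sets_restrict_space_iff) auto

lemma finite_measure_Theta: "finite_measure Theta"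
  by (rule finite_measure_lebesgue_on) simp

lemma AE_Theta_iff: "(AE \<theta> in Theta. P \<theta>) \<longleftrightarrow> (AE \<theta> in lebesgue. \<theta> \<in> {0..1} \<longrightarrow> P \<theta>)"
  by (rule AE_restrict_space_iff) simp

lemma integrable_bounded_Theta:
  fixes h :: "real \<Rightarrow> 'b::{banach, second_countable_topology}"
  assumes "h \<in> borel_measurable Theta" "AE \<theta> in Theta. norm (h \<theta>) \<le> c"
  shows "integrable Theta h"
  using finite_measure.integrable_const_bound[OF finite_measure_Theta assms(2,1)] .

lemma L2prof_bounded:
  assumes "x \<in> borel_measurable Theta" "AE \<theta> in Theta. norm (x \<theta>) \<le> c"
  shows "L2prof x"
  unfolding L2prof_def
proof
  show "integrable Theta (\<lambda>\<theta>. (norm (x \<theta>))\<^sup>2)"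
  proof (rule integrable_bounded_Theta[where c = "c\<^sup>2"])
    show "AE \<theta> in Theta. norm ((norm (x \<theta>))\<^sup>2) \<le> c\<^sup>2"
      using assms(2) by eventually_elim (simp add: power_mono)
    show "(\<lambda>\<theta>. (norm (x \<theta>))\<^sup>2) \<in> borel_measurable Theta"
      using assms(1) by measurable
  qed
qed (fact assms(1))

lemma borel_measurable_Theta_AE_cong:
  fixes x z :: "real \<Rightarrow> real ^ 't"
  assumes "x \<in> borel_measurable Theta" "AE \<theta> in Theta. x \<theta> = z \<theta>"
  shows "z \<in> borel_measurable Theta"
proof -
  have "(\<lambda>\<theta>. if \<theta> \<in> {0..1} then x \<theta> else 0) \<in> borel_measurable lebesgue"
    using assms(1) by (rule borel_measurable_if_I) simp
  then have "(\<lambda>\<theta>. if \<theta> \<in> {0..1} then z \<theta> else 0) \<in> borel_measurable lebesgue"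
    by (rule borel_measurable_AE) (use assms(2) in \<open>auto simp: AE_Theta_iff elim: eventually_mono\<close>)
  then show ?thesis by (rule borel_measurable_if_D)
qed

text \<open>A Lebesgue measurable function of \<theta> does not in general give a Borel set in the
  product with the action space; a Borel version does, as the projection theorem requires.\<close>

lemma borel_version_Theta:
  fixes x :: "real \<Rightarrow> real ^ 't"
  assumes "x \<in> borel_measurable Theta"
  obtains z where "z \<in> borel_measurable borel" "AE \<theta> in Theta. x \<theta> = z \<theta>"
proof -
  define y where "y = (\<lambda>\<theta>. if \<theta> \<in> {0..1} then x \<theta> else 0)"
  have "y \<in> borel_measurable lebesgue"
    unfolding y_def using assms by (rule borel_measurable_if_I) simp
  then have "(\<lambda>\<theta>. y \<theta> $ i) \<in> borel_measurable lebesgue" for i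
    by (rule measurable_compose[OF _ borel_measurable_nth])
  then have "\<exists>w\<in>borel_measurable lborel. AE \<theta> in lborel. y \<theta> $ i = w \<theta>" for i
    by (rule completion_ex_borel_measurable_real)
  then obtain w where w: "\<And>i. w i \<in> borel_measurable lborel" "\<And>i. AE \<theta> in lborel. y \<theta> $ i = w i \<theta>"
    by metis
  show ?thesis
  proof
    show "(\<lambda>\<theta>. \<chi> i. w i \<theta>) \<in> borel_measurable borel"
      by (subst borel_measurable_euclidean_space) (auto simp: Basis_vec_def inner_axis w(1)[simplified])
    have "AE \<theta> in lborel. \<forall>i. y \<theta> $ i = w i \<theta>"
      using w(2) by (simp add: AE_all_countable)
    then have "AE \<theta> in lebesgue. \<forall>i. y \<theta> $ i = w i \<theta>"
      by (rule AE_completion)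
    then show "AE \<theta> in Theta. x \<theta> = (\<chi> i. w i \<theta>)"
      unfolding AE_Theta_iff by eventually_elim (auto simp: vec_eq_iff y_def)
  qed
qed

text \<open>Total mass 1 makes the aggregate a coordinatewise average, so it stays in the box where
  (N2) controls the costs.\<close>

lemma aggregate_in_Mbox:
  fixes x :: "real \<Rightarrow> real ^ 't"
  assumes "feasible Xs x" "\<And>\<theta>. \<theta> \<in> {0..1} \<Longrightarrow> Xs \<theta> \<subseteq> Mbox M"
  shows "aggregate x \<in> Mbox M"
proof -
  have AE: "AE \<theta> in Theta. x \<theta> \<in> Mbox M"
    using assms unfolding feasible_def AE_Theta_iff by (auto elim: eventually_mono)
  have "0 \<le> aggregate x $ i \<and> aggregate x $ i \<le> M + 1" for i
  proof -
    have AEi: "AE \<theta> in Theta. 0 \<le> x \<theta> $ i \<and> x \<theta> $ i \<le> M + 1"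
      using AE by eventually_elim (auto simp: Mbox_def mem_box_cart)
    have "(\<lambda>\<theta>. x \<theta> $ i) \<in> borel_measurable Theta"
      using assms(1) unfolding feasible_def L2prof_def
      by (intro measurable_compose[OF _ borel_measurable_nth]) auto
    then have "integrable Theta (\<lambda>\<theta>. x \<theta> $ i)"
      by (rule integrable_bounded_Theta[where c = "M + 1"]) (use AEi in \<open>auto elim: eventually_mono\<close>)
    then have "(LINT \<theta>|Theta. x \<theta> $ i) \<le> (LINT \<theta>|Theta. M + 1)"
      by (rule integral_mono_AE) (use AEi in \<open>auto simp: finite_measure.integrable_const[OF finite_measure_Theta] elim: eventually_mono\<close>)
    moreover have "0 \<le> (LINT \<theta>|Theta. x \<theta> $ i)"
      by (rule integral_nonneg_AE) (use AEi in \<open>auto elim: eventually_mono\<close>)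
    ultimately show ?thesis by (simp add: aggregate_def)
  qed
  then show ?thesis by (simp add: Mbox_def mem_box_cart)
qed

text \<open>A player set on which the inequality fails by \<open>\<epsilon>\<close> is a projection of a Borel set; a
  measurable selection of the violating actions on it would make the integral negative.\<close>
lemma pointwise_of_integral_variational_inequality:
  fixes Xs :: "real \<Rightarrow> (real ^ 't) set"
  assumes conv: "\<And>\<theta>. \<theta> \<in> {0..1} \<Longrightarrow> convex (Xs \<theta>)"
    and comp: "\<And>\<theta>. \<theta> \<in> {0..1} \<Longrightarrow> compact (Xs \<theta>)"
    and graph: "graph_corr Xs \<in> sets borel"
    and ball: "\<And>\<theta>. \<theta> \<in> {0..1} \<Longrightarrow> Xs \<theta> \<subseteq> cball 0 M"
    and x: "feasible Xs x"
    and g: "g \<in> borel_measurable Theta" "AE \<theta> in Theta. norm (g \<theta>) \<le> K"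
    and vi: "\<And>z. feasible Xs z \<Longrightarrow> (LINT \<theta>|Theta. g \<theta> \<bullet> (z \<theta> - x \<theta>)) \<ge> 0"
  shows "AE \<theta> in Theta. \<forall>y\<in>Xs \<theta>. g \<theta> \<bullet> (y - x \<theta>) \<ge> 0"
proof -
  have x_meas: "x \<in> borel_measurable Theta" and x_in: "AE \<theta> in Theta. x \<theta> \<in> Xs \<theta>"
    using x by (auto simp: feasible_def L2prof_def)
  obtain x' where x': "x' \<in> borel_measurable borel" "AE \<theta> in Theta. x \<theta> = x' \<theta>"
    using borel_version_Theta[OF x_meas] .
  obtain g' where g': "g' \<in> borel_measurable borel" "AE \<theta> in Theta. g \<theta> = g' \<theta>"
    using borel_version_Theta[OF g(1)] .
  have "AE \<theta> in Theta. \<forall>y\<in>Xs \<theta>. \<not> g \<theta> \<bullet> (y - x \<theta>) \<le> - \<epsilon>" if "\<epsilon> > 0" for \<epsilon>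
  proof -
    define B where "B = graph_corr Xs \<inter> {p. g' (fst p) \<bullet> (snd p - x' (fst p)) \<le> - \<epsilon>}"
    have "fst \<in> borel_measurable (borel :: (real \<times> (real ^ 't)) measure)"
      by (intro borel_measurable_continuous_onI continuous_on_fst continuous_on_id)
    then have gx_meas: "(\<lambda>p :: real \<times> (real ^ 't). g' (fst p)) \<in> borel_measurable borel"
        "(\<lambda>p :: real \<times> (real ^ 't). x' (fst p)) \<in> borel_measurable borel"
      using measurable_compose g'(1) x'(1) by blast+
    have "{p. g' (fst p) \<bullet> (snd p - x' (fst p)) \<le> - \<epsilon>} \<in> sets borel"
    proof -
      have "snd \<in> borel_measurable (borel :: (real \<times> (real ^ 't)) measure)"
        by (intro borel_measurable_continuous_onI continuous_on_snd continuous_on_id)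
      then have "{p \<in> space borel. g' (fst p) \<bullet> (snd p - x' (fst p)) \<le> - \<epsilon>} \<in> sets borel"
        using gx_meas by measurable
      then show ?thesis by simp
    qed
    then have B: "B \<in> sets borel" using graph by (auto simp: B_def)
    define E where "E = fst ` B"
    have E: "E \<in> sets Theta"
      using sets_lebesgue_fst_image[OF B] by (auto simp: sets_Theta E_def B_def graph_corr_def)
    \<comment> \<open>The singleton keeps every player outside \<open>E\<close> at the original
      action, up to a null set, so the integrand vanishes there.\<close>
    define F where "F = (\<lambda>\<theta>. if \<theta> \<in> E then {y \<in> Xs \<theta>. g' \<theta> \<bullet> (y - x' \<theta>) \<le> - \<epsilon>} else {x' \<theta>})"
    have F: "convex (F \<theta>) \<and> closed (F \<theta>) \<and> F \<theta> \<noteq> {}" if \<theta>: "\<theta> \<in> {0..1}" for \<theta>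
    proof (cases "\<theta> \<in> E")
      case True
      have "F \<theta> = Xs \<theta> \<inter> {y. g' \<theta> \<bullet> y \<le> g' \<theta> \<bullet> x' \<theta> - \<epsilon>}"
        using True by (auto simp: F_def inner_diff_right)
      moreover have "F \<theta> \<noteq> {}"
        using True by (auto simp: F_def E_def B_def graph_corr_def)
      ultimately show ?thesis
        using conv[OF \<theta>] compact_imp_closed[OF comp[OF \<theta>]]
        by (auto intro: convex_Int convex_halfspace_le closed_Int closed_halfspace_le)
    qed (auto simp: F_def)
    have "measurable_corr Theta F"
      unfolding measurable_corr_def
    proof (intro allI impI)
      fix U :: "(real ^ 't) set" assume U: "open U"
      let ?R = "fst ` (B \<inter> UNIV \<times> U) \<union> ({0..1} \<inter> x' -` U - E)"
      have hit: "F \<theta> \<inter> U \<noteq> {} \<longleftrightarrow> \<theta> \<in> ?R"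
        if "\<theta> \<in> {0..1}" for \<theta>
      proof (cases "\<theta> \<in> E")
        case True
        then have "F \<theta> \<inter> U \<noteq> {} \<longleftrightarrow> (\<exists>y. (\<theta>, y) \<in> B \<and> y \<in> U)"
          using that by (auto simp: F_def B_def graph_corr_def)
        then show ?thesis using True by (force simp: image_iff)
      next
        case False
        then show ?thesis using that by (auto simp: F_def E_def)
      qed
      have "?R \<subseteq> {0..1}" by (auto simp: B_def graph_corr_def)
      then have "{\<theta> \<in> space Theta. F \<theta> \<inter> U \<noteq> {}} = ?R"
        unfolding Theta_simps using hit by (intro set_eqI) (metis (mono_tags, lifting) mem_Collect_eq subsetD)
      also have "\<dots> \<in> sets Theta"
      proof (rule sets.Un)
        have "UNIV \<times> U \<in> sets (borel :: (real \<times> (real ^ 't)) measure)"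
          using U by (auto intro: borel_open open_Times)
        then show "fst ` (B \<inter> UNIV \<times> U) \<in> sets Theta"
          using sets_lebesgue_fst_image[of "B \<inter> UNIV \<times> U"] B
          by (auto simp: sets_Theta B_def graph_corr_def)
        have "x' -` U \<in> sets borel"
          using measurable_sets[OF x'(1), of U] U by simp
        then have "{0..1} \<inter> x' -` U \<in> sets Theta"
          by (auto simp: sets_Theta)
        then show "{0..1} \<inter> x' -` U - E \<in> sets Theta"
          using E by (rule sets.Diff)
      qed
      finally show "{\<theta> \<in> space Theta. F \<theta> \<inter> U \<noteq> {}} \<in> sets Theta" .
    qed
    define z where "z = (\<lambda>\<theta>. closest_point (F \<theta>) 0)"
    have z_meas: "z \<in> borel_measurable Theta"
      unfolding z_def
      by (rule borel_measurable_closest_point) (use F \<open>measurable_corr Theta F\<close> in auto)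
    have zF: "z \<theta> \<in> F \<theta>" if "\<theta> \<in> {0..1}" for \<theta>
      using F[OF that] by (simp add: z_def closest_point_in_set)
    have in01: "AE \<theta> in Theta. \<theta> \<in> {0..1}"
      by (rule AE_I2) simp
    have z_in: "AE \<theta> in Theta. z \<theta> \<in> Xs \<theta>"
      using x_in x'(2) in01
    proof eventually_elim
      case (elim \<theta>)
      then show ?case using zF[of \<theta>] by (auto simp: F_def split: if_splits)
    qed
    have "feasible Xs z"
      unfolding feasible_def
    proof
      have "AE \<theta> in Theta. norm (z \<theta>) \<le> M"
        using z_in in01 by eventually_elim (use ball in force)
      with z_meas show "L2prof z" by (rule L2prof_bounded)
    qed (fact z_in)
    then have "0 \<le> (LINT \<theta>|Theta. g \<theta> \<bullet> (z \<theta> - x \<theta>))" by (rule vi)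
    also have "\<dots> \<le> (LINT \<theta>|Theta. - \<epsilon> * indicat_real E \<theta>)"
    proof (rule integral_mono_AE)
      \<comment> \<open>The bound provides integrability. Without it the integral could be 0 by
        convention and could not be compared.\<close>
      have "AE \<theta> in Theta. norm (g \<theta> \<bullet> (z \<theta> - x \<theta>)) \<le> K * (2 * M)"
        using g(2) x_in z_in in01
      proof eventually_elim
        case (elim \<theta>)
        then have "norm (x \<theta>) \<le> M" "norm (z \<theta>) \<le> M" using ball[of \<theta>] by auto
        then have "norm (z \<theta> - x \<theta>) \<le> 2 * M"
          using norm_triangle_ineq4[of "z \<theta>" "x \<theta>"] by linarith
        then have "norm (g \<theta>) * norm (z \<theta> - x \<theta>) \<le> K * (2 * M)"
          using elim(1) norm_ge_zero[of "g \<theta>"] by (intro mult_mono norm_ge_zero) linarith+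
        then show ?case using Cauchy_Schwarz_ineq2[of "g \<theta>" "z \<theta> - x \<theta>"] by simp
      qed
      moreover have "(\<lambda>\<theta>. g \<theta> \<bullet> (z \<theta> - x \<theta>)) \<in> borel_measurable Theta"
        using g(1) z_meas x_meas by measurable
      ultimately show "integrable Theta (\<lambda>\<theta>. g \<theta> \<bullet> (z \<theta> - x \<theta>))"
        by (intro integrable_bounded_Theta)
      show "integrable Theta (\<lambda>\<theta>. - \<epsilon> * indicat_real E \<theta>)"
        using E that by (intro integrable_bounded_Theta[where c = \<epsilon>]) (auto simp: indicator_def)
      show "AE \<theta> in Theta. g \<theta> \<bullet> (z \<theta> - x \<theta>) \<le> - \<epsilon> * indicat_real E \<theta>"
        using x'(2) g'(2) in01
      proof eventually_elim
        case (elim \<theta>)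
        then show ?case using zF[of \<theta>] by (cases "\<theta> \<in> E") (auto simp: F_def)
      qed
    qed
    also have "\<dots> = - \<epsilon> * measure Theta E"
      using E by (simp add: sets_Theta Int_absorb2)
    finally have "measure Theta E = 0"
      using that measure_nonneg[of Theta E] by (auto simp: mult_le_0_iff)
    then have "E \<in> null_sets Theta"
      using E finite_measure.emeasure_eq_measure[OF finite_measure_Theta, of E] by (auto intro: null_setsI)
    then have "AE \<theta> in Theta. \<theta> \<notin> E" by (rule AE_not_in)
    then show ?thesis
      using x'(2) g'(2) in01
    proof eventually_elim
      case (elim \<theta>)
      then show ?case by (force simp: E_def B_def graph_corr_def image_iff)
    qed
  qed
  then have "AE \<theta> in Theta. \<forall>n. \<forall>y\<in>Xs \<theta>. \<not> g \<theta> \<bullet> (y - x \<theta>) \<le> - inverse (Suc n)"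
    unfolding AE_all_countable by (simp del: of_nat_Suc)
  then show ?thesis
  proof eventually_elim
    case (elim \<theta>)
    show ?case
    proof (intro ballI leI notI)
      fix y assume y: "y \<in> Xs \<theta>" "g \<theta> \<bullet> (y - x \<theta>) < 0"
      then obtain n where "inverse (Suc n) < - (g \<theta> \<bullet> (y - x \<theta>))"
        using reals_Archimedean[of "- (g \<theta> \<bullet> (y - x \<theta>))"] by auto
      moreover have "\<not> g \<theta> \<bullet> (y - x \<theta>) \<le> - inverse (Suc n)" using elim y(1) by blast
      ultimately show False by linarith
    qed
  qed
qed

section \<open>Equilibria\<close>

theorem mainTheorem1:
  fixes Xs :: "real \<Rightarrow> (real ^ 't) set"
    and f :: "real \<Rightarrow> real ^ 't \<Rightarrow> real ^ 't \<Rightarrow> real"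
    and M :: real and M' :: "(real ^ 't) set"
    and xs :: "real \<Rightarrow> real ^ 't"
  assumes M_pos: "M > 0"
    and M'_open: "open M'" and M'_nbhd: "Mbox M \<subseteq> M'"
    \<comment> \<open>(N1)\<close>
    and N1_ne: "\<forall>\<theta>\<in>{0..1}. Xs \<theta> \<noteq> {}"
    and N1_convex: "\<forall>\<theta>\<in>{0..1}. convex (Xs \<theta>)"
    and N1_compact: "\<forall>\<theta>\<in>{0..1}. compact (Xs \<theta>)"
    and N1_graph: "graph_corr Xs \<in> sets (borel :: (real \<times> (real ^ 't)) measure)"
    and N1_ball: "\<forall>\<theta>\<in>{0..1}. Xs \<theta> \<subseteq> cball 0 M"
    \<comment> \<open>implicit: actions lie in the domain box where f is defined and assumed convex\<close>
    and N1_dom: "\<forall>\<theta>\<in>{0..1}. Xs \<theta> \<subseteq> Mbox M"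
    \<comment> \<open>(N2)\<close>
    and N2_bdd: "\<forall>\<theta>\<in>{0..1}. bounded ((\<lambda>(x, Y). f \<theta> x Y) ` (Mbox M \<times> Mbox M))"
    and N2_meas: "\<forall>Y\<in>Mbox M. (\<lambda>(\<theta>, x). f \<theta> x Y) \<in> borel_measurable (restrict_space borel (graph_corr Xs))"
    and N2_cont: "\<forall>Y\<in>Mbox M. \<forall>\<theta>\<in>{0..1}. continuous_on M' (\<lambda>x. f \<theta> x Y)"
    and N2_convex: "\<forall>Y\<in>Mbox M. \<forall>\<theta>\<in>{0..1}. convex_on M' (\<lambda>x. f \<theta> x Y)"
    and N2_subgrad: "\<exists>Bf>0. \<forall>\<theta>\<in>{0..1}. \<forall>x\<in>Mbox M. \<forall>Y\<in>Mbox M.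
                        \<forall>g\<in>subdiff (\<lambda>z. f \<theta> z Y) M' x. norm g \<le> Bf"
    \<comment> \<open>(N3)\<close>
    and N3: "\<forall>Y\<in>aggr_set Xs. \<forall>x\<in>best_resp Xs f Y. measurable_corr Theta (Dcorr Xs f M' x Y)"
    and xs_feas: "feasible Xs xs"
  shows "(wardrop_eq Xs f xs \<longleftrightarrow>
            (AE \<theta> in Theta. \<exists>g\<in>subdiff (\<lambda>z. f \<theta> z (aggregate xs)) M' (xs \<theta>).
                 \<forall>y\<in>Xs \<theta>. g \<bullet> (y - xs \<theta>) \<ge> 0))
       \<and> (wardrop_eq Xs f xs \<longleftrightarrow>
            (\<exists>g\<in>Hset f M' xs. \<forall>x. feasible Xs x \<longrightarrow>
                 (LINT \<theta>|Theta. g \<theta> \<bullet> (x \<theta> - xs \<theta>)) \<ge> 0))"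
proof -
  define Y where "Y = aggregate xs"
  have Y: "Y \<in> Mbox M"
    unfolding Y_def using xs_feas N1_dom by (intro aggregate_in_Mbox) auto
  have Xs_M': "Xs \<theta> \<subseteq> M'" if "\<theta> \<in> {0..1}" for \<theta>
    using N1_dom M'_nbhd that by blast
  have in01: "AE \<theta> in Theta. \<theta> \<in> {0..1}"
    by (rule AE_I2) simp
  have xs_meas: "xs \<in> borel_measurable Theta" and xs_in: "AE \<theta> in Theta. xs \<theta> \<in> Xs \<theta>"
    using xs_feas by (auto simp: feasible_def L2prof_def)
  obtain Bf where Bf: "\<And>\<theta> x g. \<theta> \<in> {0..1} \<Longrightarrow> x \<in> Mbox M \<Longrightarrow>
      g \<in> subdiff (\<lambda>z. f \<theta> z Y) M' x \<Longrightarrow> norm g \<le> Bf"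
    using N2_subgrad Y by blast
  \<comment> \<open>Stated for an arbitrary profile because it is applied to \<open>xs\<close> at
    almost every player and to its corrected version at every player.\<close>
  have ne_D: "Dcorr Xs f M' x Y \<theta> \<noteq> {}"
    if opt: "\<theta> \<in> {0..1}" "x \<theta> \<in> Xs \<theta>" "\<forall>y\<in>Xs \<theta>. f \<theta> (x \<theta>) Y \<le> f \<theta> y Y" for x \<theta>
  proof -
    obtain g where "g \<in> subdiff (\<lambda>z. f \<theta> z Y) M' (x \<theta>)" "\<And>y. y \<in> Xs \<theta> \<Longrightarrow> g \<bullet> (y - x \<theta>) \<ge> 0"
      by (rule constrained_minimizer_subgradient[of M' "\<lambda>z. f \<theta> z Y" "Xs \<theta>" "x \<theta>"])
        (use opt M'_open N2_convex N1_convex Xs_M' Y in auto)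
    then show ?thesis by (auto simp: Dcorr_def)
  qed
  let ?A = "AE \<theta> in Theta. \<exists>g\<in>subdiff (\<lambda>z. f \<theta> z Y) M' (xs \<theta>). \<forall>y\<in>Xs \<theta>. g \<bullet> (y - xs \<theta>) \<ge> 0"
  let ?B = "\<exists>g\<in>Hset f M' xs. \<forall>x. feasible Xs x \<longrightarrow> (LINT \<theta>|Theta. g \<theta> \<bullet> (x \<theta> - xs \<theta>)) \<ge> 0"
  have A_imp: "wardrop_eq Xs f xs" if ?A
  proof -
    have "AE \<theta> in Theta. \<forall>y\<in>Xs \<theta>. f \<theta> (xs \<theta>) Y \<le> f \<theta> y Y"
      using that in01
    proof eventually_elim
      case (elim \<theta>)
      show ?case
      proof
        fix y assume y: "y \<in> Xs \<theta>"
        from elim(1) obtain g where g: "g \<in> subdiff (\<lambda>z. f \<theta> z Y) M' (xs \<theta>)" "\<forall>y\<in>Xs \<theta>. g \<bullet> (y - xs \<theta>) \<ge> 0"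
          by blast
        have "f \<theta> (xs \<theta>) Y + g \<bullet> (y - xs \<theta>) \<le> f \<theta> y Y"
          using g(1) y Xs_M'[OF elim(2)] by (auto simp: subdiff_def)
        moreover have "g \<bullet> (y - xs \<theta>) \<ge> 0" using g(2) y by blast
        ultimately show "f \<theta> (xs \<theta>) Y \<le> f \<theta> y Y" by linarith
      qed
    qed
    then show ?thesis using xs_feas by (simp add: wardrop_eq_def Y_def)
  qed
  have imp_A: ?A if "wardrop_eq Xs f xs"
  proof -
    have "AE \<theta> in Theta. \<forall>y\<in>Xs \<theta>. f \<theta> (xs \<theta>) Y \<le> f \<theta> y Y"
      using that by (simp add: wardrop_eq_def Y_def)
    then show ?thesis
      using xs_in in01
    proof eventually_elim
      case (elim \<theta>)
      then show ?case using ne_D[of \<theta> xs] by (auto simp: Dcorr_def)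
    qed
  qed
  have B_imp: ?A if ?B
  proof -
    from that obtain g where g: "g \<in> Hset f M' xs"
      "\<And>x. feasible Xs x \<Longrightarrow> (LINT \<theta>|Theta. g \<theta> \<bullet> (x \<theta> - xs \<theta>)) \<ge> 0"
      by blast
    have g_meas: "g \<in> borel_measurable Theta"
      and g_sub: "AE \<theta> in Theta. g \<theta> \<in> subdiff (\<lambda>z. f \<theta> z Y) M' (xs \<theta>)"
      using g(1) by (auto simp: Hset_def L2prof_def Y_def)
    have "AE \<theta> in Theta. norm (g \<theta>) \<le> Bf"
      using g_sub xs_in in01 by eventually_elim (use Bf N1_dom in blast)
    then have "AE \<theta> in Theta. \<forall>y\<in>Xs \<theta>. g \<theta> \<bullet> (y - xs \<theta>) \<ge> 0"
      using N1_convex N1_compact N1_ball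
      by (intro pointwise_of_integral_variational_inequality[OF _ _ N1_graph _ xs_feas g_meas _ g(2)]) auto
    then show ?thesis
      using g_sub by eventually_elim blast
  qed
  have imp_B: ?B if WE: "wardrop_eq Xs f xs"
  proof -
    have xs_min: "AE \<theta> in Theta. \<forall>y\<in>Xs \<theta>. f \<theta> (xs \<theta>) Y \<le> f \<theta> y Y"
      using WE by (simp add: wardrop_eq_def Y_def)
    define is_min where "is_min = (\<lambda>\<theta> v. v \<in> Xs \<theta> \<and> (\<forall>y\<in>Xs \<theta>. f \<theta> v Y \<le> f \<theta> y Y))"
    \<comment> \<open>(N3) only speaks about profiles that minimise at every player, so \<open>xs\<close> is corrected on a null set.\<close>
    define x where "x = (\<lambda>\<theta>. if is_min \<theta> (xs \<theta>) then xs \<theta> else (SOME v. is_min \<theta> v))"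
    have x_min: "is_min \<theta> (x \<theta>)" if \<theta>: "\<theta> \<in> {0..1}" for \<theta>
    proof -
      have "continuous_on (Xs \<theta>) (\<lambda>v. f \<theta> v Y)"
        using N2_cont Y \<theta> Xs_M'[OF \<theta>] by (blast intro: continuous_on_subset)
      then have "\<exists>v. is_min \<theta> v"
        using continuous_attains_inf[of "Xs \<theta>" "\<lambda>v. f \<theta> v Y"] N1_compact N1_ne \<theta>
        by (auto simp: is_min_def)
      then show ?thesis by (auto simp: x_def intro: someI_ex)
    qed
    have eq: "AE \<theta> in Theta. xs \<theta> = x \<theta>"
      using xs_min xs_in by eventually_elim (auto simp: x_def is_min_def)
    have x_meas: "x \<in> borel_measurable Theta"
      using xs_meas eq by (rule borel_measurable_Theta_AE_cong)
    have x_in: "AE \<theta> in Theta. x \<theta> \<in> Xs \<theta>"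
      using in01 by eventually_elim (use x_min in \<open>auto simp: is_min_def\<close>)
    have "AE \<theta> in Theta. norm (x \<theta>) \<le> M"
      using x_in in01 by eventually_elim (use N1_ball in force)
    with x_meas x_in have x_feas: "feasible Xs x"
      by (auto simp: feasible_def intro: L2prof_bounded)
    \<comment> \<open>The correction leaves the aggregate unchanged, so the corrected profile is a
      best response to the same \<open>Y\<close> and (N3) applies to it.\<close>
    have "aggregate x = Y"
      unfolding Y_def aggregate_def vec_eq_iff vec_lambda_beta
      using eq xs_meas x_meas
      by (intro allI integral_cong_AE measurable_compose[OF _ borel_measurable_nth])
        (auto elim: eventually_mono)
    then have "Y \<in> aggr_set Xs" using x_feas by (auto simp: aggr_set_def)
    moreover have "x \<in> best_resp Xs f Y"
      using x_feas x_min by (auto simp: best_resp_def is_min_def)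
    ultimately have D_meas: "measurable_corr Theta (Dcorr Xs f M' x Y)"
      using N3 by blast
    have D: "convex (Dcorr Xs f M' x Y \<theta>) \<and> closed (Dcorr Xs f M' x Y \<theta>) \<and> Dcorr Xs f M' x Y \<theta> \<noteq> {}"
      if \<theta>: "\<theta> \<in> {0..1}" for \<theta>
    proof -
      \<comment> \<open>As conditions on \<open>g\<close>, the subgradient and variational
        inequalities are closed half-spaces, so the nearest-point selection is available.\<close>
      have "Dcorr Xs f M' x Y \<theta> =
        (\<Inter>y\<in>M'. {g. (y - x \<theta>) \<bullet> g \<le> f \<theta> y Y - f \<theta> (x \<theta>) Y}) \<inter> (\<Inter>y\<in>Xs \<theta>. {g. (y - x \<theta>) \<bullet> g \<ge> 0})"
        by (auto simp: Dcorr_def subdiff_def inner_commute algebra_simps)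
      then have "convex (Dcorr Xs f M' x Y \<theta>)" "closed (Dcorr Xs f M' x Y \<theta>)"
        by (auto intro!: convex_Int convex_INT convex_halfspace_le convex_halfspace_ge
            closed_Int closed_INT closed_halfspace_le closed_halfspace_ge)
      then show ?thesis using ne_D[of \<theta> x] x_min[OF \<theta>] \<theta> by (simp add: is_min_def)
    qed
    define g where "g = (\<lambda>\<theta>. closest_point (Dcorr Xs f M' x Y \<theta>) 0)"
    have g_meas: "g \<in> borel_measurable Theta"
      unfolding g_def by (rule borel_measurable_closest_point) (use D D_meas in auto)
    have g_in: "g \<theta> \<in> Dcorr Xs f M' x Y \<theta>" if "\<theta> \<in> {0..1}" for \<theta>
      using D[OF that] by (simp add: g_def closest_point_in_set)
    have g_sub: "AE \<theta> in Theta. g \<theta> \<in> subdiff (\<lambda>z. f \<theta> z Y) M' (xs \<theta>)"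
      using eq in01 by eventually_elim (use g_in in \<open>auto simp: Dcorr_def\<close>)
    \<comment> \<open>The uniform bound on subgradients gives the square integrability demanded by
      \<open>Hset\<close>.\<close>
    have "AE \<theta> in Theta. norm (g \<theta>) \<le> Bf"
      using g_sub xs_in in01 by eventually_elim (use Bf N1_dom in blast)
    then have "g \<in> Hset f M' xs"
      using g_sub L2prof_bounded[OF g_meas] by (auto simp: Hset_def Y_def)
    moreover have "(LINT \<theta>|Theta. g \<theta> \<bullet> (z \<theta> - xs \<theta>)) \<ge> 0" if "feasible Xs z" for z
    proof (rule integral_nonneg_AE)
      have "AE \<theta> in Theta. z \<theta> \<in> Xs \<theta>" using that by (simp add: feasible_def)
      then show "AE \<theta> in Theta. 0 \<le> g \<theta> \<bullet> (z \<theta> - xs \<theta>)"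
        using eq in01 by eventually_elim (use g_in in \<open>auto simp: Dcorr_def\<close>)
    qed
    ultimately show ?thesis by blast
  qed
  have "wardrop_eq Xs f xs \<longleftrightarrow> ?A" using A_imp imp_A by blast
  moreover have "wardrop_eq Xs f xs \<longleftrightarrow> ?B" using A_imp B_imp imp_B by blast
  ultimately show ?thesis unfolding Y_def ..
qed

end
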